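(* Let $f_1,\dots,f_M:\mathbb{R}^n\to\mathbb{R}^n$ define the switched system $x_{k+1}=f_{\sigma(k)}(x_k)$, $k\in\mathbb{N}$, let $c:\mathbb{R}^n\to\mathbb{R}_{\ge0}$ be a cost function, and let $J$ be the value function of the system with cost $c$. Let $W:\mathbb{R}^n\to\mathbb{R}_{\ge0}$ satisfy $$W(x)\le c(x)+\max_{i\in\{1,\dots,M\}}W(f_i(x)),\qquad\forall x\in\mathbb{R}^n.$$ Assume that $W$ is continuous at $0$, that $W(0)=0$, and that all trajectories of the system converge to $0$ (i.e. for every initial state and every switching signal, $x_k\to0$ as $k\to\infty$). Then $W(x)\le J(x)$ for all $x\in\mathbb{R}^n$.
   Context: $\mathbb{N}$ includes $0$ and $M\ge1$. A switching signal is any function $\sigma:\mathbb{N}\to\{1,\dots,M\}$. For $x\in\mathbb{R}^n$, $\xi(\cdot,x,\sigma)$ denotes the solution with $\xi(0,x,\sigma)=x$ and $\xi(k+1,x,\sigma)=f_{\sigma(k)}(\xi(k,x,\sigma))$. The cost-to-go is $J_\sigma(x)=\sum_{k=0}^\infty c(\xi(k,x,\sigma))\in[0,+\infty]$ ($+\infty$ if the series diverges), and the value function is $J(x)=\sup_{\sigma:\mathbb{N}\to\{1,\dots,M\}}J_\sigma(x)$. *)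

theory Defs
  imports "HOL-Analysis.Analysis"
begin

definition switching_signals :: "nat \<Rightarrow> (nat \<Rightarrow> nat) set" where
  "switching_signals M = (UNIV \<rightarrow> {1..M})"

primrec trajectory :: "(nat \<Rightarrow> 'a \<Rightarrow> 'a) \<Rightarrow> (nat \<Rightarrow> nat) \<Rightarrow> 'a \<Rightarrow> nat \<Rightarrow> 'a" where
  "trajectory f \<sigma> x 0 = x"
| "trajectory f \<sigma> x (Suc k) = f (\<sigma> k) (trajectory f \<sigma> x k)"

(* The cost c is real-valued and meant to be nonnegative (ennreal sends negative reals to 0).
   In ennreal a divergent series of nonnegative terms has sum infinity. *)
definition cost_to_go ::
    "(nat \<Rightarrow> 'a \<Rightarrow> 'a) \<Rightarrow> ('a \<Rightarrow> real) \<Rightarrow> (nat \<Rightarrow> nat) \<Rightarrow> 'a \<Rightarrow> ennreal" where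
  "cost_to_go f c \<sigma> x = (\<Sum>k. ennreal (c (trajectory f \<sigma> x k)))"

definition value_function ::
    "nat \<Rightarrow> (nat \<Rightarrow> 'a \<Rightarrow> 'a) \<Rightarrow> ('a \<Rightarrow> real) \<Rightarrow> 'a \<Rightarrow> ennreal" where
  "value_function M f c x = (SUP \<sigma>\<in>switching_signals M. cost_to_go f c \<sigma> x)"

end

theory Submission
  imports Defs
begin

text \<open>
  The supremum defining the value function is bounded below by the cost of one well-chosen
  signal. At each state apply a mode \<open>i\<close> that maximises \<open>W (f i x)\<close>. Along the trajectory
  obtained from this greedy feedback the hypothesis on \<open>W\<close> loses its maximum and becomes
  \<open>W (x\<^sub>k) \<le> c (x\<^sub>k) + W (x\<^sub>k\<^sub>+\<^sub>1)\<close>, which telescopes to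
  \<open>W (x\<^sub>0) \<le> c (x\<^sub>0) + \<dots> + c (x\<^sub>k\<^sub>-\<^sub>1) + W (x\<^sub>k)\<close>. The trajectory tends to \<open>0\<close>, so
  continuity of \<open>W\<close> at \<open>0\<close> and \<open>W 0 = 0\<close> make the last term vanish in the limit.
\<close>

text \<open>
  A switching signal is a function of time alone, whereas the greedy choice is a function of the
  state. Once the initial state is fixed the system is deterministic, so running the closed loop
  and recording the modes it uses turns the feedback into a signal.
\<close>

lemma feedback_realised_by_signal:
  assumes "\<And>x. \<kappa> x \<in> {1..M}"
  shows "\<exists>\<sigma>\<in>switching_signals M. \<forall>k. \<sigma> k = \<kappa> (trajectory f \<sigma> x k)"
proof -
  define y where "y k = ((\<lambda>z. f (\<kappa> z) z) ^^ k) x" for k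
  define \<sigma> where "\<sigma> k = \<kappa> (y k)" for k
  have "trajectory f \<sigma> x k = y k" for k
    by (induction k) (simp_all add: y_def \<sigma>_def)
  then have "\<forall>k. \<sigma> k = \<kappa> (trajectory f \<sigma> x k)"
    by (simp add: \<sigma>_def)
  moreover have "\<sigma> \<in> switching_signals M"
    using assms by (simp add: switching_signals_def \<sigma>_def)
  ultimately show ?thesis ..
qed

lemma telescoped_cost_bound:
  fixes W c :: "'a \<Rightarrow> real"
  assumes "\<And>k. W (y k) \<le> c (y k) + W (y (Suc k))"
  shows "W (y 0) \<le> (\<Sum>j<k. c (y j)) + W (y k)"
proof (induction k)
  case (Suc k)
  then show ?case using assms[of k] by simp
qed simp

text \<open>
  Passing to the limit in the extended nonnegative reals covers convergent and divergent costs
  at once.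
\<close>

lemma le_suminf_if_remainder_vanishes:
  fixes a r :: "nat \<Rightarrow> real"
  assumes "\<And>k. 0 \<le> a k" and "\<And>k. 0 \<le> r k"
    and "\<And>k. w \<le> (\<Sum>j<k. a j) + r k" and "r \<longlonglongrightarrow> 0"
  shows "ennreal w \<le> (\<Sum>k. ennreal (a k))"
proof (rule LIMSEQ_le_const)
  have "(\<lambda>k. ennreal (r k)) \<longlonglongrightarrow> 0"
    using tendsto_ennrealI[OF assms(4)] by simp
  then have "(\<lambda>k. (\<Sum>j<k. ennreal (a j)) + ennreal (r k)) \<longlonglongrightarrow> (\<Sum>k. ennreal (a k)) + 0"
    by (intro tendsto_add summable_LIMSEQ) simp
  then show "(\<lambda>k. (\<Sum>j<k. ennreal (a j)) + ennreal (r k)) \<longlonglongrightarrow> (\<Sum>k. ennreal (a k))"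
    by simp
  have "ennreal w \<le> (\<Sum>j<k. ennreal (a j)) + ennreal (r k)" for k
  proof -
    have "ennreal w \<le> ennreal ((\<Sum>j<k. a j) + r k)"
      using assms(3) by (rule ennreal_leI)
    then show ?thesis
      using assms(1,2) by (simp add: sum_nonneg)
  qed
  then show "\<exists>N. \<forall>k\<ge>N. ennreal w \<le> (\<Sum>j<k. ennreal (a j)) + ennreal (r k)"
    by blast
qed

theorem proposition3:
  fixes M :: nat
    and f :: "nat \<Rightarrow> real ^ 'n \<Rightarrow> real ^ 'n"
    and c W :: "real ^ 'n \<Rightarrow> real"
  assumes "M \<ge> 1"
    and "\<forall>x. c x \<ge> 0"
    and "\<forall>x. W x \<ge> 0"
    and "\<forall>x. W x \<le> c x + Max ((\<lambda>i. W (f i x)) ` {1..M})"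
    and "isCont W 0"
    and "W 0 = 0"
    and "\<forall>x. \<forall>\<sigma>\<in>switching_signals M. (\<lambda>k. trajectory f \<sigma> x k) \<longlonglongrightarrow> 0"
  shows "\<forall>x. ennreal (W x) \<le> value_function M f c x"
proof
  fix x
  have "\<forall>z. \<exists>i. i \<in> {1..M} \<and> W (f i z) = Max ((\<lambda>i. W (f i z)) ` {1..M})"
  proof
    fix z
    have "Max ((\<lambda>i. W (f i z)) ` {1..M}) \<in> (\<lambda>i. W (f i z)) ` {1..M}"
      using assms(1) by (intro Max_in) auto
    then show "\<exists>i. i \<in> {1..M} \<and> W (f i z) = Max ((\<lambda>i. W (f i z)) ` {1..M})"
      by (elim imageE) (intro exI conjI, simp_all)
  qed
  from choice[OF this] obtain \<kappa>
    where "\<forall>z. \<kappa> z \<in> {1..M} \<and> W (f (\<kappa> z) z) = Max ((\<lambda>i. W (f i z)) ` {1..M})"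
    by (rule exE)
  then have \<kappa>: "\<kappa> z \<in> {1..M}"
    and greedy: "W (f (\<kappa> z) z) = Max ((\<lambda>i. W (f i z)) ` {1..M})" for z
    by simp_all
  obtain \<sigma> where \<sigma>: "\<sigma> \<in> switching_signals M"
    and closed_loop: "\<forall>k. \<sigma> k = \<kappa> (trajectory f \<sigma> x k)"
    using feedback_realised_by_signal[where \<kappa> = \<kappa> and f = f and x = x, OF \<kappa>] by (rule bexE)
  let ?y = "trajectory f \<sigma> x"
  have "W (?y k) \<le> c (?y k) + W (?y (Suc k))" for k
    using assms(4) greedy[of "?y k"] closed_loop by simp
  then have bound: "W x \<le> (\<Sum>j<k. c (?y j)) + W (?y k)" for k
    using telescoped_cost_bound[of W ?y c k] by simp
  have "?y \<longlonglongrightarrow> 0"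
    using assms(7) \<sigma> by blast
  then have "(\<lambda>k. W (?y k)) \<longlonglongrightarrow> 0"
    using isCont_tendsto_compose[OF assms(5), of ?y sequentially] assms(6) by simp
  then have "ennreal (W x) \<le> cost_to_go f c \<sigma> x"
    unfolding cost_to_go_def
    using assms(2,3) bound by (intro le_suminf_if_remainder_vanishes) auto
  also have "\<dots> \<le> value_function M f c x"
    unfolding value_function_def using \<sigma> by (rule SUP_upper)
  finally show "ennreal (W x) \<le> value_function M f c x" .
qed

end
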